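(* Let $p,q,\alpha$ satisfy one of the following: (i) $p\in[1,\infty)$, $q\in(1,\infty)$, $\alpha\in\mathbb{R}$; (ii) $p\in[1,\infty)$, $q=1$, $\alpha\le0$; (iii) $p\in(1,\infty]$, $q=\infty$, $\alpha\ge0$. Then the associate space $(\ell^{p,q;\alpha})'$ coincides with $\ell^{p',q';-\alpha}$.
   Context: $\mathcal{M}$ is the set of all sequences $a=\{a_n\}_{n=1}^\infty$ with values in $[-\infty,\infty]$; $m$ is the counting measure on $\mathbb{N}=\{1,2,\dots\}$. For $a\in\mathcal{M}$, the non-increasing rearrangement is $a_n^*=\inf\{\lambda\in[0,\infty): m(\{k:|a_k|>\lambda\})\le n-1\}$ ($\inf\emptyset=\infty$). Convention $1/\infty=0$; for $p\in[1,\infty]$, $p'\in[1,\infty]$ is given by $\frac1p+\frac1{p'}=1$. $\|a\|_q=(\sum_n|a_n|^q)^{1/q}$ for $0<q<\infty$ and $\|a\|_\infty=\sup_n|a_n|$. For $p,q\in(0,\infty]$, $\alpha\in\mathbb{R}$: $\|a\|_{p,q;\alpha}=\big\|\{a_n^*\,n^{\frac1p-\frac1q}(1+\log n)^\alpha\}_n\big\|_q$ and $\ell^{p,q;\alpha}=\{a\in\mathcal{M}:\|a\|_{p,q;\alpha}<\infty\}$. For a sequence space $X$ given by a functional $\|\cdot\|_X$, the associate functional is $\|a\|_{X'}=\sup\{\sum_{n=1}^\infty|a_nb_n|: b\in X,\ \|b\|_X\le1\}$ and $X'=\{a\in\mathcal{M}:\|a\|_{X'}<\infty\}$. Two spaces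 $X,Y$ coincide if there are constants $c,C>0$ with $c\|a\|_X\le\|a\|_Y\le C\|a\|_X$ for all $a\in\mathcal{M}$. *)

theory Defs
  imports "HOL-Analysis.Analysis"
begin

(* A sequence (a_n), n = 1, 2, ..., with values in [-\<infinity>, \<infinity>] is a function nat \<Rightarrow> ereal whose
   value at index 0 is never looked at.  Quantities with values in [0, \<infinity>] live in ennreal. *)
type_synonym eseq = "nat \<Rightarrow> ereal"

(* x^r for x in [0, \<infinity>]; only used for r > 0, where \<infinity>^r = \<infinity> and 0^r = 0. *)
definition epowr :: "ennreal \<Rightarrow> real \<Rightarrow> ennreal" where
  "epowr x r = (if x = \<infinity> then \<infinity> else ennreal (enn2real x powr r))"

(* The infimum is taken in ennreal, so the infimum of the empty set is \<infinity>. *)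
definition rearr :: "eseq \<Rightarrow> nat \<Rightarrow> ennreal" where
  "rearr a n = Inf {t :: ennreal. t < \<infinity> \<and>
     emeasure (count_space {1..}) {k \<in> {1..}. e2ennreal \<bar>a k\<bar> > t} \<le> of_nat (n - 1)}"

(* The functional || . ||_q for 0 < q \<le> \<infinity>, on sequences that are already nonnegative. *)
definition lq_norm :: "ereal \<Rightarrow> (nat \<Rightarrow> ennreal) \<Rightarrow> ennreal" where
  "lq_norm q x =
     (if q = \<infinity> then (SUP n\<in>{1..}. x n)
      else epowr (\<Sum>n. epowr (x (Suc n)) (real_of_ereal q)) (1 / real_of_ereal q))"

(* In ereal, 1 / \<infinity> = 0, so for p, q in (0, \<infinity>] the exponent 1/p - 1/q is a real number. *)
definition lz_norm :: "ereal \<Rightarrow> ereal \<Rightarrow> real \<Rightarrow> eseq \<Rightarrow> ennreal" where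
  "lz_norm p q \<alpha> a =
     lq_norm q (\<lambda>n. rearr a n *
       ennreal (real n powr real_of_ereal (1 / p - 1 / q) * (1 + ln (real n)) powr \<alpha>))"

definition conj_exp :: "ereal \<Rightarrow> ereal" where
  "conj_exp p = (THE r. 1 \<le> r \<and> 1 / p + 1 / r = 1)"

lemma conj_exp_ex1:
  assumes "1 \<le> p"
  shows "\<exists>!r :: ereal. 1 \<le> r \<and> 1 / p + 1 / r = 1"
proof (cases p)
  case (real x)
  with assms have x: "1 \<le> x" by simp
  have eq: "1 \<le> r \<and> 1 / p + 1 / r = 1 \<longleftrightarrow> r = (if x = 1 then \<infinity> else ereal (x / (x - 1)))" for r
  proof (cases r)
    case (real y)
    have "1 \<le> y" if "x \<noteq> 1" "x * y = x + y"
    proof (rule ccontr)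
      assume "\<not> 1 \<le> y"
      then have "(x - 1) * (y - 1) \<le> 0"
        using x by (simp add: mult_nonneg_nonpos)
      then show False using that by (simp add: algebra_simps)
    qed
    with real show ?thesis using x \<open>p = ereal x\<close>
      by (auto simp: one_ereal_def divide_ereal_def field_simps split: if_splits)
  next
    case PInf
    then show ?thesis using x \<open>p = ereal x\<close>
      by (auto simp: one_ereal_def divide_ereal_def field_simps split: if_splits)
  qed auto
  show ?thesis unfolding eq by simp
next
  case PInf
  have "1 \<le> r \<and> 1 / p + 1 / r = 1 \<longleftrightarrow> r = 1" for r :: ereal
    using PInf by (cases r) (auto simp: one_ereal_def divide_ereal_def field_simps split: if_splits)
  then show ?thesis by simp
qed (use assms in auto)

(* A sequence space X is given by its functional N = || . ||_X; as a set it consists of the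
   sequences on which N is finite. *)
definition carrier_of :: "(eseq \<Rightarrow> ennreal) \<Rightarrow> eseq set" where
  "carrier_of N = {a. N a < \<infinity>}"

definition assoc_norm :: "(eseq \<Rightarrow> ennreal) \<Rightarrow> eseq \<Rightarrow> ennreal" where
  "assoc_norm N a =
     (SUP b\<in>{b \<in> carrier_of N. N b \<le> 1}. \<Sum>n. e2ennreal \<bar>a (Suc n) * b (Suc n)\<bar>)"

definition spaces_coincide :: "(eseq \<Rightarrow> ennreal) \<Rightarrow> (eseq \<Rightarrow> ennreal) \<Rightarrow> bool" where
  "spaces_coincide N M \<longleftrightarrow>
     (\<exists>c C :: real. c > 0 \<and> C > 0 \<and> (\<forall>a. ennreal c * N a \<le> M a \<and> M a \<le> ennreal C * N a))"

end

theory Submission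
  imports Defs
begin

text \<open>Write \<open>w n = n powr (1/p - 1/q) * (1 + ln n) powr \<alpha>\<close>; the weight of the dual space is \<open>1 / w\<close>.
  By the Hardy--Littlewood rearrangement inequality and Hoelder's inequality the associate norm is at
  most the norm of the dual Lorentz--Zygmund space.

  Conversely, a non-increasing finitely supported \<open>g\<close> with \<open>\<parallel>g w\<parallel> \<le> 1\<close> can be placed on positions where
  \<open>\<bar>a\<bar>\<close> is at least half of its rearrangement \<open>f\<close>, so \<open>\<Sum> f g\<close> is at most twice the associate norm.
  For \<open>q = \<infinity>\<close> take \<open>g = 1 / w\<close>; for \<open>q = 1\<close> take normalised indicators of initial segments.
  For \<open>1 < q < \<infinity>\<close> the extremal sequence \<open>v\<close> of Hoelder's inequality need not be
  non-increasing, and is replaced by its tail sums \<open>\<Sum>k\<ge>n. v k / k\<close>, which are controlled by a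
  weighted Hardy inequality. Both finite cases use only that the partial sums of \<open>w powr q\<close> are
  dominated by \<open>n * w n powr q\<close>, which holds because \<open>p < \<infinity>\<close>.\<close>

section \<open>Weighted inequalities for real sequences\<close>

lemma sum_triangle_swap:
  fixes a :: "nat \<Rightarrow> nat \<Rightarrow> 'a::comm_monoid_add"
  shows "(\<Sum>n=1..K. \<Sum>k=n..K. a n k) = (\<Sum>k=1..K. \<Sum>n=1..k. a n k)"
proof (induction K)
  case (Suc K)
  have "(\<Sum>n=1..Suc K. \<Sum>k=n..Suc K. a n k) = (\<Sum>n=1..Suc K. (\<Sum>k=n..K. a n k) + a n (Suc K))"
    by (intro sum.cong) auto
  with Suc show ?case by (simp add: sum.distrib)
qed simp

text \<open>Young's inequality applied to the normalised terms \<open>x i / X\<close> and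
  \<open>y i / Y\<close>. Bounds \<open>X\<close>, \<open>Y\<close> stand in place of the norms, so
  that the norm of a whole series can serve for its finite sections.\<close>

lemma sum_Holder_bound:
  fixes x y :: "'a \<Rightarrow> real"
  assumes pq: "1 < p" "1 < q" "1 / p + 1 / q = 1"
    and nonneg: "\<And>i. i \<in> I \<Longrightarrow> 0 \<le> x i" "\<And>i. i \<in> I \<Longrightarrow> 0 \<le> y i" "0 \<le> X" "0 \<le> Y"
    and bounds: "(\<Sum>i\<in>I. x i powr p) \<le> X powr p" "(\<Sum>i\<in>I. y i powr q) \<le> Y powr q"
  shows "(\<Sum>i\<in>I. x i * y i) \<le> X * Y"
proof (cases "finite I \<and> X \<noteq> 0 \<and> Y \<noteq> 0")
  case True
  then have pos: "0 < X" "0 < Y" using nonneg by auto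
  have "(\<Sum>i\<in>I. (x i / X) * (y i / Y)) \<le> (\<Sum>i\<in>I. (x i / X) powr p / p + (y i / Y) powr q / q)"
    using pq nonneg pos by (intro sum_mono Youngs_inequality) auto
  also have "\<dots> = (\<Sum>i\<in>I. x i powr p) / X powr p / p + (\<Sum>i\<in>I. y i powr q) / Y powr q / q"
    using nonneg pos by (simp add: sum.distrib powr_divide sum_divide_distrib)
  also have "\<dots> \<le> 1 / p + 1 / q"
    using bounds pos pq by (intro add_mono divide_right_mono) (auto simp: divide_le_eq)
  finally have "(\<Sum>i\<in>I. x i * y i) / (X * Y) \<le> 1"
    using pq by (simp add: sum_divide_distrib)
  then show ?thesis using pos by (simp add: divide_le_eq)
next
  case False
  \<comment> \<open>Degenerate cases: a zero bound forces every term of that factor to vanish, and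
    an infinite \<open>I\<close> gives the default value 0 of \<open>sum\<close>.\<close>
  have zero: "\<forall>i\<in>I. z i = 0" if "finite I" "(\<Sum>i\<in>I. z i powr r) \<le> 0" for z :: "'a \<Rightarrow> real" and r
  proof -
    have "(\<Sum>i\<in>I. z i powr r) = 0"
      using that(2) sum_nonneg[of I "\<lambda>i. z i powr r"] by simp
    then show ?thesis using that by (simp add: sum_nonneg_eq_0_iff)
  qed
  have "(\<Sum>i\<in>I. x i * y i) = 0"
  proof (cases "finite I")
    case True
    with False consider "X = 0" | "Y = 0" by auto
    then show ?thesis
    proof cases
      case 1 then show ?thesis using zero[of x p] bounds True by simp
    next
      case 2 then show ?thesis using zero[of y q] bounds True by simp
    qed
  qed simp
  then show ?thesis using nonneg by simp
qed

section \<open>Power weights with logarithmic factors\<close>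

lemma one_plus_ln_powr_le:
  fixes \<epsilon> :: real
  assumes "0 < \<epsilon>" "1 \<le> x"
  shows "1 + ln x \<le> (1 + 1 / \<epsilon>) * x powr \<epsilon>"
proof -
  have "ln (x powr \<epsilon>) \<le> x powr \<epsilon> - 1"
    using assms by (intro ln_le_minus_one) auto
  then have "ln x \<le> (x powr \<epsilon> - 1) / \<epsilon>"
    using assms by (simp add: ln_powr field_simps)
  moreover have "1 \<le> x powr \<epsilon>" using assms by (intro ge_one_powr_ge_zero) auto
  moreover have "(x powr \<epsilon> - 1) / \<epsilon> \<le> x powr \<epsilon> / \<epsilon>"
    using assms by (intro divide_right_mono) auto
  ultimately show ?thesis by (simp add: algebra_simps)
qed

text \<open>For \<open>\<gamma> \<ge> 0\<close> both factors increase. For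
  \<open>\<gamma> = - m < 0\<close> the logarithm grows from \<open>x\<close> to \<open>y\<close> by
  at most the factor \<open>1 + ln (y / x)\<close>, which is dominated by
  \<open>(y / x) powr (\<epsilon> / m)\<close>; the m-th power of this is compensated by the growth
  of the power factor.\<close>

lemma powr_log_almost_increasing:
  fixes \<epsilon> \<gamma> :: real
  assumes "0 < \<epsilon>"
  obtains C where "0 < C"
    "\<And>x y. 1 \<le> x \<Longrightarrow> x \<le> y \<Longrightarrow> x powr \<epsilon> * (1 + ln x) powr \<gamma> \<le> C * (y powr \<epsilon> * (1 + ln y) powr \<gamma>)"
proof (cases "0 \<le> \<gamma>")
  case True
  have "x powr \<epsilon> * (1 + ln x) powr \<gamma> \<le> 1 * (y powr \<epsilon> * (1 + ln y) powr \<gamma>)"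
    if "1 \<le> x" "x \<le> y" for x y :: real
    unfolding mult_1 using that True assms by (intro mult_mono powr_mono2) auto
  then show ?thesis using that[of 1] by auto
next
  case False
  define m where "m = - \<gamma>"
  have \<gamma>: "\<gamma> = - m" and m: "0 < m" using False by (simp_all add: m_def)
  define D where "D = 1 + 1 / (\<epsilon> / m)"
  have D: "1 \<le> D" using m assms by (simp add: D_def)
  have "x powr \<epsilon> * (1 + ln x) powr \<gamma> \<le> D powr m * (y powr \<epsilon> * (1 + ln y) powr \<gamma>)"
    if xy: "1 \<le> x" "x \<le> y" for x y :: real
  proof -
    have lx: "1 \<le> 1 + ln x" and ly: "1 \<le> 1 + ln y" using xy by auto
    have "1 + ln y = (1 + ln x) + ln (y / x)" using xy by (simp add: ln_div)
    also have "\<dots> \<le> (1 + ln x) * (1 + ln (y / x))"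
      using xy by (simp add: algebra_simps)
    also have "\<dots> \<le> (1 + ln x) * (D * (y / x) powr (\<epsilon> / m))"
      unfolding D_def using xy m assms lx by (intro mult_left_mono one_plus_ln_powr_le) auto
    finally have "(1 + ln y) powr m \<le> ((1 + ln x) * (D * (y / x) powr (\<epsilon> / m))) powr m"
      using m ly by (intro powr_mono2) auto
    also have "\<dots> = (1 + ln x) powr m * D powr m * (y powr \<epsilon> / x powr \<epsilon>)"
      using m D xy lx by (simp add: powr_mult powr_powr powr_divide)
    finally have "(1 + ln y) powr m \<le> (1 + ln x) powr m * D powr m * (y powr \<epsilon> / x powr \<epsilon>)" .
    then have "x powr \<epsilon> * (1 + ln y) powr m \<le> D powr m * y powr \<epsilon> * (1 + ln x) powr m"
      using xy by (simp add: field_simps)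
    moreover have "0 < (1 + ln x) powr m" "0 < (1 + ln y) powr m" using lx ly by auto
    ultimately show ?thesis
      unfolding \<gamma> by (simp add: powr_minus divide_inverse[symmetric] divide_le_eq pos_le_divide_eq mult_ac)
  qed
  then show ?thesis using that[of "D powr m"] D by auto
qed

text \<open>Comparison with the telescoping differences of \<open>n powr \<delta>\<close>: the mean
  value theorem bounds each from below by the derivative at the right endpoint, because the exponent
  \<open>\<delta> - 1\<close> is not positive.\<close>

lemma sum_powr_minus_one_le:
  fixes \<delta> :: real
  assumes "0 < \<delta>" "\<delta> \<le> 1"
  shows "(\<Sum>n=1..k. real n powr (\<delta> - 1)) \<le> real k powr \<delta> / \<delta>"
proof (induction k)
  case 0
  then show ?case by simp
next
  case (Suc k)
  have "\<delta> * real (Suc k) powr (\<delta> - 1) \<le> real (Suc k) powr \<delta> - real k powr \<delta>"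
  proof (cases "k = 0")
    case True
    then show ?thesis using assms by simp
  next
    case False
    have "\<exists>z>real k. z < real (Suc k) \<and>
        real (Suc k) powr \<delta> - real k powr \<delta> = (real (Suc k) - real k) * (\<delta> * z powr (\<delta> - 1))"
      using False by (intro MVT2) (auto intro!: derivative_eq_intros)
    then obtain z where z: "real k < z" "z < real (Suc k)"
      "real (Suc k) powr \<delta> - real k powr \<delta> = \<delta> * z powr (\<delta> - 1)" by auto
    have "real (Suc k) powr (\<delta> - 1) \<le> z powr (\<delta> - 1)"
      using z assms False by (intro powr_mono2') auto
    then show ?thesis using z assms by simp
  qed
  then have "real (Suc k) powr (\<delta> - 1) \<le> (real (Suc k) powr \<delta> - real k powr \<delta>) / \<delta>"
    using assms by (simp add: field_simps)
  with Suc show ?case by (simp add: diff_divide_distrib)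
qed

text \<open>The part \<open>n powr (\<beta> - \<delta>)\<close> of the power, together with the
  logarithm, is almost increasing and is replaced by its value at \<open>k\<close>; the remaining
  \<open>n powr (\<delta> - 1)\<close> is summed without logarithms.\<close>

lemma sum_powr_log_le:
  fixes \<beta> \<gamma> :: real
  assumes "0 < \<beta>"
  obtains C where "0 < C"
    "\<And>k. (\<Sum>n=1..k. real n powr (\<beta> - 1) * (1 + ln (real n)) powr \<gamma>)
         \<le> C * (real k powr \<beta> * (1 + ln (real k)) powr \<gamma>)"
proof -
  \<comment> \<open>The 1 respects the range of \<open>sum_powr_minus_one_le\<close>;
    \<open>\<beta> / 2\<close> keeps the exponent \<open>\<beta> - \<delta>\<close>
    positive.\<close>
  define \<delta> where "\<delta> = min 1 (\<beta> / 2)"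
  have \<delta>: "0 < \<delta>" "\<delta> \<le> 1" "0 < \<beta> - \<delta>" using assms by (auto simp: \<delta>_def min_def)
  obtain C where C: "0 < C" "\<And>x y. 1 \<le> x \<Longrightarrow> x \<le> y \<Longrightarrow>
      x powr (\<beta> - \<delta>) * (1 + ln x) powr \<gamma> \<le> C * (y powr (\<beta> - \<delta>) * (1 + ln y) powr \<gamma>)"
    using powr_log_almost_increasing[OF \<delta>(3)] by blast
  have "(\<Sum>n=1..k. real n powr (\<beta> - 1) * (1 + ln (real n)) powr \<gamma>)
         \<le> C / \<delta> * (real k powr \<beta> * (1 + ln (real k)) powr \<gamma>)" for k
  proof -
    let ?L = "C * (real k powr (\<beta> - \<delta>) * (1 + ln (real k)) powr \<gamma>)"
    have "(\<Sum>n=1..k. real n powr (\<beta> - 1) * (1 + ln (real n)) powr \<gamma>)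
        \<le> (\<Sum>n=1..k. real n powr (\<delta> - 1) * ?L)"
    proof (rule sum_mono)
      fix n assume n: "n \<in> {1..k}"
      have "real n powr (\<beta> - 1) * (1 + ln (real n)) powr \<gamma>
          = real n powr (\<delta> - 1) * (real n powr (\<beta> - \<delta>) * (1 + ln (real n)) powr \<gamma>)"
        by (simp add: powr_add[symmetric] mult.assoc[symmetric])
      also have "\<dots> \<le> real n powr (\<delta> - 1) * ?L"
        using n by (intro mult_left_mono C) auto
      finally show "real n powr (\<beta> - 1) * (1 + ln (real n)) powr \<gamma> \<le> real n powr (\<delta> - 1) * ?L" .
    qed
    also have "\<dots> = (\<Sum>n=1..k. real n powr (\<delta> - 1)) * ?L"
      by (simp only: sum_distrib_right)
    also have "\<dots> \<le> real k powr \<delta> / \<delta> * ?L"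
      using C(1) by (intro mult_right_mono sum_powr_minus_one_le \<delta>) auto
    also have "\<dots> = C / \<delta> * ((real k powr \<delta> * real k powr (\<beta> - \<delta>)) * (1 + ln (real k)) powr \<gamma>)"
      by simp
    also have "real k powr \<delta> * real k powr (\<beta> - \<delta>) = real k powr \<beta>"
      by (simp add: powr_add[symmetric])
    finally show ?thesis .
  qed
  then show ?thesis using that[of "C / \<delta>"] C(1) \<delta>(1) by auto
qed

section \<open>Tail sums and the weighted Hardy inequality\<close>

lemma powr_diff_le:
  fixes a b q :: real
  assumes "0 \<le> a" "a \<le> b" "1 < q"
  shows "b powr q - a powr q \<le> q * (b - a) * b powr (q - 1)"
proof (cases "a = b")
  case False
  with assms have "a < b" by simp
  show ?thesis
  \<comment> \<open>The mean value argument differentiates \<open>powr\<close> at a positive base;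
    for \<open>a = 0\<close> the claim is \<open>b powr q \<le> q * b powr q\<close>.\<close>
  proof (cases "a = 0")
    case True
    have "b powr q = b * b powr (q - 1)"
      using \<open>a < b\<close> True powr_add[of b 1 "q - 1"] by simp
    moreover have "1 * (b * b powr (q - 1)) \<le> q * (b * b powr (q - 1))"
      using assms by (intro mult_right_mono) auto
    ultimately show ?thesis using True assms by simp
  next
    case a0: False
    have "\<exists>z>a. z < b \<and> b powr q - a powr q = (b - a) * (q * z powr (q - 1))"
      using assms a0 \<open>a < b\<close> by (intro MVT2) (auto intro!: derivative_eq_intros)
    then obtain z where z: "a < z" "z < b"
      "b powr q - a powr q = (b - a) * (q * z powr (q - 1))" by auto
    have "z powr (q - 1) \<le> b powr (q - 1)"
      using z assms by (intro powr_mono2) auto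
    then have "(b - a) * (q * z powr (q - 1)) \<le> (b - a) * (q * b powr (q - 1))"
      using assms \<open>a < b\<close> by (intro mult_left_mono) auto
    then show ?thesis using z by (simp add: mult_ac)
  qed
qed auto

text \<open>Discrete form of integrating the derivative of a q-th power: lowering \<open>n\<close>
  by one adds \<open>u n\<close> to the tail sum, and \<open>powr_diff_le\<close> bounds the growth
  of its power. Hence the induction runs downwards from \<open>K\<close>.\<close>

lemma tail_sum_powr_le:
  fixes u :: "nat \<Rightarrow> real"
  assumes u: "\<And>k. 0 \<le> u k" and q: "1 < q"
  shows "(\<Sum>k=n..K. u k) powr q \<le> q * (\<Sum>k=n..K. u k * (\<Sum>j=k..K. u j) powr (q - 1))"
proof (cases "n \<le> K")
  case True
  then show ?thesis
  proof (induction n rule: inc_induct)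
    case base
    have "u K powr q = u K * u K powr (q - 1)"
      using u[of K] powr_add[of "u K" 1 "q - 1"] by (cases "u K = 0") auto
    moreover have "1 * (u K * u K powr (q - 1)) \<le> q * (u K * u K powr (q - 1))"
      using u q by (intro mult_right_mono) auto
    ultimately show ?case by simp
  next
    case (step n)
    have split: "sum h {n..K} = h n + sum h {Suc n..K}" for h :: "nat \<Rightarrow> real"
      using step.hyps by (intro sum.atLeast_Suc_atMost) simp
    have "sum u {n..K} powr q - sum u {Suc n..K} powr q
        \<le> q * (sum u {n..K} - sum u {Suc n..K}) * sum u {n..K} powr (q - 1)"
      using u q by (intro powr_diff_le) (auto simp: split intro: sum_nonneg)
    also have "sum u {n..K} - sum u {Suc n..K} = u n" by (simp add: split)
    finally show ?case using step.IH
      unfolding split[of "\<lambda>k. u k * (\<Sum>j=k..K. u j) powr (q - 1)"] by (simp add: algebra_simps)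
  qed
qed simp

text \<open>For the tail sums G, the preceding lemma and a change of the order of summation bound the left
  side by the sum of v w (G w) powr (q - 1), and Hoelder's inequality absorbs the second factor.\<close>
lemma Hardy_tail_sum:
  fixes v w :: "nat \<Rightarrow> real"
  assumes q: "1 < q" and C: "0 < C" and w: "\<And>n. 1 \<le> n \<Longrightarrow> 0 < w n" and v: "\<And>n. 0 \<le> v n"
    and B: "\<And>k. (\<Sum>n=1..k. w n powr q) \<le> C * (real k * w k powr q)"
    and V: "0 \<le> V" "(\<Sum>n=1..K. (v n * w n) powr q) \<le> V powr q"
  shows "(\<Sum>n=1..K. ((\<Sum>k=n..K. v k / real k) * w n) powr q) \<le> (q * C * V) powr q"
proof -
  define G where "G n = (\<Sum>k=n..K. v k / real k)" for n
  have G0: "0 \<le> G n" for n using v by (auto simp: G_def intro!: sum_nonneg)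
  define S where "S = (\<Sum>n=1..K. (G n * w n) powr q)"
  have S0: "0 \<le> S" unfolding S_def by (intro sum_nonneg) auto
  define r where "r = q / (q - 1)"
  have r: "1 < r" "1 / q + 1 / r = 1" using q by (auto simp: r_def field_simps)
  have "S \<le> (\<Sum>n=1..K. \<Sum>k=n..K. q * (v k / real k * G k powr (q - 1)) * w n powr q)"
    unfolding S_def
  proof (rule sum_mono)
    fix n assume n: "n \<in> {1..K}"
    have "(G n * w n) powr q = G n powr q * w n powr q"
      using G0 w[of n] n by (simp add: powr_mult)
    also have "\<dots> \<le> (q * (\<Sum>k=n..K. v k / real k * G k powr (q - 1))) * w n powr q"
      unfolding G_def using v q by (intro mult_right_mono tail_sum_powr_le) auto
    finally show "(G n * w n) powr q
        \<le> (\<Sum>k=n..K. q * (v k / real k * G k powr (q - 1)) * w n powr q)"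
      by (simp add: sum_distrib_left sum_distrib_right)
  qed
  also have "\<dots> = (\<Sum>k=1..K. \<Sum>n=1..k. q * (v k / real k * G k powr (q - 1)) * w n powr q)"
    by (rule sum_triangle_swap)
  \<comment> \<open>In the inner sum only \<open>w n powr q\<close> depends on \<open>n\<close>; the
    factor \<open>k\<close> supplied by \<open>B\<close> cancels the divisor in
    \<open>v k / k\<close>.\<close>
  also have "\<dots> \<le> (\<Sum>k=1..K. q * C * ((v k * w k) * (G k * w k) powr (q - 1)))"
  proof (rule sum_mono)
    fix k assume k: "k \<in> {1..K}"
    have "(\<Sum>n=1..k. q * (v k / real k * G k powr (q - 1)) * w n powr q)
        = q * (v k / real k * G k powr (q - 1)) * (\<Sum>n=1..k. w n powr q)"
      by (simp only: sum_distrib_left)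
    also have "\<dots> \<le> q * (v k / real k * G k powr (q - 1)) * (C * (real k * w k powr q))"
      using q v by (intro mult_left_mono B) auto
    also have "w k powr q = w k * w k powr (q - 1)"
      using w[of k] k powr_add[of "w k" 1 "q - 1"] by simp
    also have "q * (v k / real k * G k powr (q - 1)) * (C * (real k * (w k * w k powr (q - 1))))
        = q * C * ((v k * w k) * (G k * w k) powr (q - 1))"
      using k G0 w[of k] by (simp add: powr_mult)
    finally show "(\<Sum>n=1..k. q * (v k / real k * G k powr (q - 1)) * w n powr q)
        \<le> q * C * ((v k * w k) * (G k * w k) powr (q - 1))" .
  qed
  also have "\<dots> = q * C * (\<Sum>k=1..K. (v k * w k) * (G k * w k) powr (q - 1))"
    by (simp only: sum_distrib_left)
  also have "\<dots> \<le> q * C * (V * S powr (1 / r))"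
  proof (intro mult_left_mono sum_Holder_bound[where p = q and q = r])
    \<comment> \<open>By conjugacy the r-th powers of the second Hoelder factor sum to
      \<open>S\<close> again.\<close>
    have "(q - 1) * r = q" using q by (simp add: r_def)
    then show "(\<Sum>i=1..K. ((G i * w i) powr (q - 1)) powr r) \<le> (S powr (1 / r)) powr r"
      using r S0 by (simp add: powr_powr S_def)
    show "0 \<le> v i * w i" if "i \<in> {1..K}" for i using v w[of i] that by simp
  qed (use q r V C in auto)
  finally have le: "S \<le> (q * C * V) * S powr (1 / r)" by (simp add: mult_ac)
  have "S \<le> (q * C * V) powr q"
  \<comment> \<open>\<open>S\<close> is a finite sum of reals, so a nonzero
    \<open>S powr (1 / r)\<close> may be cancelled, leaving \<open>S powr (1 / q)\<close>.\<close>
  proof (cases "S = 0")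
    case False
    then have "0 < S" using S0 by simp
    have "S = S powr (1 / q) * S powr (1 / r)"
      using \<open>0 < S\<close> r by (simp add: powr_add[symmetric])
    with le have "S powr (1 / q) * S powr (1 / r) \<le> (q * C * V) * S powr (1 / r)" by simp
    then have "S powr (1 / q) \<le> q * C * V"
      using \<open>0 < S\<close> by simp
    then have "(S powr (1 / q)) powr q \<le> (q * C * V) powr q"
      using q by (intro powr_mono2) auto
    then show ?thesis using q \<open>0 < S\<close> by (simp add: powr_powr)
  qed simp
  then show ?thesis by (simp add: S_def G_def)
qed

text \<open>With the extremal sequence v = f powr (r - 1) / w powr r of Hoelder's inequality, the tail sums
  of v k / k form a non-increasing test sequence which pairs with f at least as well as v does.\<close>
lemma norm_le_of_test_sequences:
  fixes f w :: "nat \<Rightarrow> real"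
  assumes q: "1 < q" "1 < r" "1 / q + 1 / r = 1" and C: "0 < C" and A: "0 \<le> A"
    and w: "\<And>n. 1 \<le> n \<Longrightarrow> 0 < w n"
    and f: "\<And>n. 0 \<le> f n" "\<And>m n. 1 \<le> m \<Longrightarrow> m \<le> n \<Longrightarrow> f n \<le> f m"
    and B: "\<And>k. (\<Sum>n=1..k. w n powr q) \<le> C * (real k * w k powr q)"
    and test: "\<And>g K. (\<And>n. 0 \<le> g n) \<Longrightarrow> (\<And>m n. 1 \<le> m \<Longrightarrow> m \<le> n \<Longrightarrow> g n \<le> g m) \<Longrightarrow>
        (\<And>n. n > K \<Longrightarrow> g n = 0) \<Longrightarrow> (\<Sum>n=1..K. (g n * w n) powr q) \<le> 1 \<Longrightarrow>
        (\<Sum>n=1..K. f n * g n) \<le> A"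
  shows "(\<Sum>n=1..K. (f n / w n) powr r) \<le> (q * C * A) powr r"
proof -
  define S where "S = (\<Sum>n=1..K. (f n / w n) powr r)"
  have S0: "0 \<le> S" unfolding S_def by (intro sum_nonneg) auto
  show ?thesis
  proof (cases "S = 0")
    case False
    then have "0 < S" using S0 by simp
    define v where "v n = f n powr (r - 1) / w n powr r" for n
    define G where "G n = (\<Sum>k=n..K. v k / real k)" for n
    \<comment> \<open>\<open>V\<close> is the l^q norm of \<open>v * w\<close> on
      \<open>1..K\<close>, since \<open>(v n * w n) powr q = (f n / w n) powr r\<close>.
      \<open>D\<close> is the resulting Hardy bound, which makes \<open>G / D\<close> an admissible
      test sequence.\<close>
    define V where "V = S powr (1 / q)"
    define D where "D = q * C * V"
    have V: "0 < V" using \<open>0 < S\<close> by (simp add: V_def)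
    have D: "0 < D" using V q C by (simp add: D_def)
    have v0: "0 \<le> v n" for n by (simp add: v_def)
    have G0: "0 \<le> G n" for n using v0 by (auto simp: G_def intro!: sum_nonneg)
    have rq: "(r - 1) * q = r" using q by (simp add: field_simps)
    have vw: "(v n * w n) powr q = (f n / w n) powr r" if "n \<in> {1..K}" for n
    proof -
      have wn: "0 < w n" using w[of n] that by simp
      have "w n powr r = w n * w n powr (r - 1)"
        using wn powr_add[of "w n" 1 "r - 1"] by simp
      then have "v n * w n = (f n / w n) powr (r - 1)"
        using wn f(1)[of n] by (simp add: v_def powr_divide)
      then show ?thesis by (simp add: powr_powr rq)
    qed
    have Hardy: "(\<Sum>n=1..K. (G n * w n) powr q) \<le> D powr q"
      unfolding G_def D_def
    proof (rule Hardy_tail_sum[OF q(1) C w v0 B])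
      show "0 \<le> V" using V by simp
      have "(\<Sum>n=1..K. (v n * w n) powr q) = S" unfolding S_def by (intro sum.cong refl vw)
      also have "S = V powr q" using \<open>0 < S\<close> q by (simp add: V_def powr_powr)
      finally show "(\<Sum>n=1..K. (v n * w n) powr q) \<le> V powr q" by simp
    qed
    have "S \<le> (\<Sum>n=1..K. f n * G n)"
    proof -
      \<comment> \<open>The k-th term is spread evenly over \<open>1..k\<close>, where
        \<open>f n \<ge> f k\<close> by monotonicity.\<close>
      have "S \<le> (\<Sum>k=1..K. \<Sum>n=1..k. f n * (v k / real k))"
        unfolding S_def
      proof (rule sum_mono)
        fix k assume k: "k \<in> {1..K}"
        have "f k powr r = f k * f k powr (r - 1)"
          using f(1)[of k] powr_add[of "f k" 1 "r - 1"] by (cases "f k = 0") auto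
        then have "(f k / w k) powr r = (\<Sum>n=1..k. f k * (v k / real k))"
          using w[of k] k f(1)[of k] by (simp add: v_def powr_divide)
        also have "\<dots> \<le> (\<Sum>n=1..k. f n * (v k / real k))"
          using f v0 by (intro sum_mono mult_right_mono) auto
        finally show "(f k / w k) powr r \<le> (\<Sum>n=1..k. f n * (v k / real k))" .
      qed
      also have "\<dots> = (\<Sum>n=1..K. \<Sum>k=n..K. f n * (v k / real k))"
        by (rule sum_triangle_swap[symmetric])
      finally show ?thesis by (simp add: G_def sum_distrib_left)
    qed
    moreover have "(\<Sum>n=1..K. f n * (G n / D)) \<le> A"
    proof (rule test)
      show "0 \<le> G n / D" for n using G0 D by simp
      show "G n / D \<le> G m / D" if "1 \<le> m" "m \<le> n" for m n
        unfolding G_def using D that v0 by (intro divide_right_mono sum_mono2) auto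
      show "G n / D = 0" if "n > K" for n using that by (simp add: G_def)
      have "(\<Sum>n=1..K. (G n / D * w n) powr q) = (\<Sum>n=1..K. (G n * w n) powr q) / D powr q"
        unfolding sum_divide_distrib using w D G0
        by (intro sum.cong refl) (simp add: powr_mult powr_divide)
      also have "\<dots> \<le> 1" using Hardy D by (simp add: divide_le_eq)
      finally show "(\<Sum>n=1..K. (G n / D * w n) powr q) \<le> 1" .
    qed
    ultimately have "S \<le> A * D"
      using D by (simp add: sum_divide_distrib[symmetric] divide_le_eq)
    moreover have "S = S powr (1 / r) * V"
      using \<open>0 < S\<close> q by (simp add: V_def powr_add[symmetric] add.commute)
    ultimately have "S powr (1 / r) * V \<le> (q * C * A) * V" by (simp add: D_def mult_ac)
    then have "S powr (1 / r) \<le> q * C * A" using V by simp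
    then have "(S powr (1 / r)) powr r \<le> (q * C * A) powr r"
      using q by (intro powr_mono2) auto
    then show ?thesis using q \<open>0 < S\<close> unfolding S_def[symmetric] by (simp add: powr_powr)
  qed (simp add: S_def)
qed

section \<open>Rearrangements\<close>

text \<open>For \<open>t < u\<close> the level set above \<open>t\<close> contains \<open>S\<close>,
  so it has more than \<open>n - 1\<close> points and \<open>t\<close> does not enter the
  infimum.\<close>

lemma le_rearr:
  assumes "finite S" "card S = n" "1 \<le> n" "S \<subseteq> {1..}" "\<And>k. k \<in> S \<Longrightarrow> u \<le> e2ennreal \<bar>a k\<bar>"
  shows "u \<le> rearr a n"
  unfolding rearr_def
proof (rule Inf_greatest, rule ccontr)
  fix t assume t: "t \<in> {t. t < \<infinity> \<and>
      emeasure (count_space {1..}) {k \<in> {1..}. e2ennreal \<bar>a k\<bar> > t} \<le> of_nat (n - 1)}"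
    and "\<not> u \<le> t"
  then have sub: "S \<subseteq> {k \<in> {1..}. e2ennreal \<bar>a k\<bar> > t}"
    using assms(4,5) by (force simp: not_le dest: less_le_trans)
  have "(of_nat n :: ennreal) = emeasure (count_space {1..}) S"
    using assms by (simp add: emeasure_count_space)
  also have "\<dots> \<le> emeasure (count_space {1..}) {k \<in> {1..}. e2ennreal \<bar>a k\<bar> > t}"
    using sub by (intro emeasure_mono) auto
  also have "\<dots> \<le> of_nat (n - 1)" using t by simp
  finally show False using \<open>1 \<le> n\<close> by simp
qed

text \<open>The strict inequality keeps \<open>u\<close> out of the infimum, so its level set has at
  least \<open>n\<close> points. That set may be infinite, hence only an n-element subset is
  produced.\<close>

lemma less_rearrD:
  assumes "u < rearr a n" "1 \<le> n"
  obtains S where "finite S" "card S = n" "S \<subseteq> {k \<in> {1..}. u < e2ennreal \<bar>a k\<bar>}"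
proof -
  let ?E = "{k \<in> {1..}. u < e2ennreal \<bar>a k\<bar>}"
  have "u < \<infinity>" using assms(1) order.strict_trans2 top_greatest by (metis infinity_ennreal_def) 
  then have "\<not> emeasure (count_space {1..}) ?E \<le> of_nat (n - 1)"
    using assms(1) Inf_lower[of u] unfolding rearr_def by (fastforce simp: not_le[symmetric])
  then have "finite ?E \<Longrightarrow> n \<le> card ?E"
    using assms(2) by (subst (asm) emeasure_count_space_finite) auto
  then obtain S where "finite S" "card S = n" "S \<subseteq> ?E"
    using infinite_arbitrarily_large[of ?E n] obtain_subset_with_card_n[of n ?E] by blast
  then show ?thesis using that by blast
qed

lemma rearr_antimono: "m \<le> n \<Longrightarrow> rearr a n \<le> rearr a m"
  unfolding rearr_def
  by (intro Inf_superset_mono) (auto elim!: order_trans)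

lemma rearr_le:
  assumes "u < \<infinity>" "finite S" "card S < n" "{k \<in> {1..}. u < e2ennreal \<bar>a k\<bar>} \<subseteq> S"
  shows "rearr a n \<le> u"
proof (rule ccontr)
  assume "\<not> ?thesis"
  then have "u < rearr a n" "1 \<le> n" using assms by auto
  then obtain T where "card T = n" "T \<subseteq> {k \<in> {1..}. u < e2ennreal \<bar>a k\<bar>}"
    using less_rearrD by blast
  then show False using assms card_mono[of S T] by auto
qed

section \<open>The Hardy--Littlewood rearrangement inequality\<close>

text \<open>Layer cake: f n is the integral over s of the indicator of s < f n.\<close>
lemma suminf_le_of_level_sets:
  fixes f u f' u' :: "nat \<Rightarrow> ennreal"
  assumes "\<And>s. 0 \<le> s \<Longrightarrow> (\<Sum>n. indicator {n. ennreal s < f n} n * u n)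
                      \<le> (\<Sum>n. indicator {n. ennreal s < f' n} n * u' n)"
  shows "(\<Sum>n. f n * u n) \<le> (\<Sum>n. f' n * u' n)"
proof -
  define I where "I h s n = (indicator {s. 0 \<le> s \<and> ennreal s < h n} s :: ennreal)" for h :: "nat \<Rightarrow> ennreal" and s n
  have meas: "{s. 0 \<le> s \<and> ennreal s < x} \<in> sets lborel"
    and emeas: "emeasure lborel {s. 0 \<le> s \<and> ennreal s < x} = x" for x
  proof -
    have "{s. 0 \<le> s \<and> ennreal s < x} \<in> sets lborel \<and>
        emeasure lborel {s. 0 \<le> s \<and> ennreal s < x} = x"
    proof (cases x)
      case (real r)
      then have "{s. 0 \<le> s \<and> ennreal s < x} = {0..<r}" by (auto simp: ennreal_less_iff)
      then show ?thesis using real by simp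
    next
      \<comment> \<open>The layers of an infinite value fill the half-line, whose measure is at
        least every natural number.\<close>
      case top
      have "(of_nat n :: ennreal) \<le> emeasure lborel {0::real..}" for n
      proof -
        have "(of_nat n :: ennreal) = emeasure lborel {0..real n}"
          by (simp add: ennreal_of_nat_eq_real_of_nat)
        also have "\<dots> \<le> emeasure lborel {0::real..}" by (intro emeasure_mono) auto
        finally show ?thesis .
      qed
      then have "\<not> emeasure lborel {0::real..} < top"
        using ennreal_Ex_less_of_nat by (meson leD)
      then have "emeasure lborel {0::real..} = top" by (simp add: less_top[symmetric])
      moreover have "{s. 0 \<le> s \<and> ennreal s < x} = {0..}" using top by auto
      ultimately show ?thesis using top by simp
    qed
    then show "{s. 0 \<le> s \<and> ennreal s < x} \<in> sets lborel"
      "emeasure lborel {s. 0 \<le> s \<and> ennreal s < x} = x" by blast+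
  qed
  have rep: "(\<Sum>n. h n * v n) = (\<integral>\<^sup>+s. (\<Sum>n. I h s n * v n) \<partial>lborel)" for h v
    using meas emeas by (subst nn_integral_suminf) (auto simp: I_def nn_integral_multc)
  have "(\<Sum>n. I f s n * u n) \<le> (\<Sum>n. I f' s n * u' n)" for s
  proof (cases "0 \<le> s")
    case True
    then show ?thesis using assms[of s] by (simp add: I_def indicator_def)
  qed (simp add: I_def)
  then show ?thesis unfolding rep[of f u] rep[of f' u'] by (rule nn_integral_mono)
qed

text \<open>The left side counts the indices at which both sequences exceed their levels. If there
  are at least \<open>i + 1\<close> of them, both rearrangements exceed the levels at position
  \<open>i + 1\<close>, so the right side counts at least as many.\<close>

lemma level_sets_rearr_le:
  fixes a b :: eseq
  assumes "0 \<le> s" "0 \<le> t"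
  shows "(\<Sum>n. indicator {n. ennreal s < e2ennreal \<bar>a (Suc n)\<bar>} n * indicator {n. ennreal t < e2ennreal \<bar>b (Suc n)\<bar>} n)
    \<le> (\<Sum>n. indicator {n. ennreal s < rearr a (Suc n)} n * indicator {n. ennreal t < rearr b (Suc n)} n :: ennreal)"
    (is "_ \<le> (\<Sum>n. ?R n)")
proof (rule suminf_le_const)
  fix N
  define S where "S = {n \<in> {..<N}. ennreal s < e2ennreal \<bar>a (Suc n)\<bar> \<and> ennreal t < e2ennreal \<bar>b (Suc n)\<bar>}"
  have R: "?R i = 1" if i: "i < card S" for i
  proof -
    obtain T where T: "T \<subseteq> S" "card T = Suc i" "finite T"
      using i obtain_subset_with_card_n[of "Suc i" S] by auto
    have ne: "Suc ` T \<noteq> {}" using T by auto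
    have less: "ennreal u < rearr c (Suc i)"
      if "\<And>k. k \<in> S \<Longrightarrow> ennreal u < e2ennreal \<bar>c (Suc k)\<bar>" for u c
    proof -
      \<comment> \<open>\<open>le_rearr\<close> gives only a non-strict bound; strictness comes from
        the minimum over the finite set \<open>T\<close>, which still exceeds
        \<open>u\<close>.\<close>
      have "Min ((\<lambda>k. e2ennreal \<bar>c k\<bar>) ` Suc ` T) \<le> rearr c (Suc i)"
        using T by (intro le_rearr[of "Suc ` T"]) (auto simp: card_image)
      moreover have "ennreal u < Min ((\<lambda>k. e2ennreal \<bar>c k\<bar>) ` Suc ` T)"
        using T ne that by (subst Min_gr_iff) auto
      ultimately show ?thesis by (rule order.strict_trans2[rotated])
    qed
    show ?thesis using less[of s a] less[of t b] by (simp add: S_def)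
  qed
  have "(\<Sum>n<N. indicator {n. ennreal s < e2ennreal \<bar>a (Suc n)\<bar>} n * indicator {n. ennreal t < e2ennreal \<bar>b (Suc n)\<bar>} n)
      = (\<Sum>n<N. indicator S n :: ennreal)"
    by (intro sum.cong) (auto simp: S_def indicator_def)
  also have "\<dots> = of_nat (card S)"
    by (simp add: S_def indicator_def sum.If_cases Int_def)
  also have "\<dots> = (\<Sum>n<card S. ?R n)"
    using R by simp
  also have "\<dots> \<le> (\<Sum>n. ?R n)" by (intro sum_le_suminf) auto
  finally show "(\<Sum>n<N. indicator {n. ennreal s < e2ennreal \<bar>a (Suc n)\<bar>} n * indicator {n. ennreal t < e2ennreal \<bar>b (Suc n)\<bar>} n)
      \<le> (\<Sum>n. ?R n)" .
qed auto

lemma e2ennreal_abs_mult: "e2ennreal \<bar>x * y\<bar> = e2ennreal \<bar>x\<bar> * e2ennreal \<bar>y\<bar>"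
proof -
  have "\<bar>x * y\<bar> = enn2ereal (e2ennreal \<bar>x\<bar> * e2ennreal \<bar>y\<bar>)"
    by (simp add: ereal_abs_mult times_ennreal.rep_eq enn2ereal_e2ennreal)
  then show ?thesis by (simp only: e2ennreal_enn2ereal)
qed

text \<open>Two applications of the layer-cake lemma, first to \<open>a\<close> and then, at a fixed
  level \<open>s\<close>, to \<open>b\<close>, reduce the claim to indicators of level sets.\<close>

lemma Hardy_Littlewood_rearr:
  "(\<Sum>n. e2ennreal \<bar>a (Suc n) * b (Suc n)\<bar>) \<le> (\<Sum>n. rearr a (Suc n) * rearr b (Suc n))"
  unfolding e2ennreal_abs_mult
proof (rule suminf_le_of_level_sets)
  fix s :: real assume "0 \<le> s"
  have "(\<Sum>n. e2ennreal \<bar>b (Suc n)\<bar> * indicator {n. ennreal s < e2ennreal \<bar>a (Suc n)\<bar>} n)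
      \<le> (\<Sum>n. rearr b (Suc n) * indicator {n. ennreal s < rearr a (Suc n)} n)"
  proof (rule suminf_le_of_level_sets)
    fix t :: real assume "0 \<le> t"
    from level_sets_rearr_le[OF \<open>0 \<le> s\<close> this, of a b]
    show "(\<Sum>n. indicator {n. ennreal t < e2ennreal \<bar>b (Suc n)\<bar>} n * indicator {n. ennreal s < e2ennreal \<bar>a (Suc n)\<bar>} n)
        \<le> (\<Sum>n. indicator {n. ennreal t < rearr b (Suc n)} n * indicator {n. ennreal s < rearr a (Suc n)} n :: ennreal)"
      by (simp only: mult.commute)
  qed
  then show "(\<Sum>n. indicator {n. ennreal s < e2ennreal \<bar>a (Suc n)\<bar>} n * e2ennreal \<bar>b (Suc n)\<bar>)
      \<le> (\<Sum>n. indicator {n. ennreal s < rearr a (Suc n)} n * rearr b (Suc n))"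
    by (simp add: mult.commute)
qed

section \<open>Norms and test sequences\<close>

lemma epowr_ennreal: "0 \<le> x \<Longrightarrow> epowr (ennreal x) r = ennreal (x powr r)"
  by (simp add: epowr_def)

lemma epowr_1 [simp]: "epowr x 1 = x"
  by (cases x) (auto simp: epowr_def)

lemma epowr_mono: "0 \<le> r \<Longrightarrow> x \<le> y \<Longrightarrow> epowr x r \<le> epowr y r"
  by (cases x; cases y) (auto simp: epowr_def top_unique intro!: ennreal_leI powr_mono2)

lemma lq_norm_one: "lq_norm 1 X = (\<Sum>n. X (Suc n))"
  by (simp add: lq_norm_def)

lemma lq_norm_mono:
  assumes "0 < q" "\<And>n. 1 \<le> n \<Longrightarrow> X n \<le> Y n"
  shows "lq_norm q X \<le> lq_norm q Y"
proof (cases "q = \<infinity>")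
  case True
  then show ?thesis using assms by (auto simp: lq_norm_def intro!: SUP_mono)
next
  case False
  then have "0 < real_of_ereal q" using assms(1) by (cases q) auto
  then show ?thesis using False assms
    by (auto simp: lq_norm_def intro!: epowr_mono suminf_le)
qed

text \<open>Reduces a bound on the extended-valued norm to real partial sums;
  \<open>lq_norm_le_ennrealD\<close> goes the other way.\<close>

lemma lq_norm_le_ennreal:
  fixes x :: "nat \<Rightarrow> real"
  assumes "0 < q" "0 \<le> c" and X: "\<And>n. 1 \<le> n \<Longrightarrow> X n = ennreal (x n)" "\<And>n. 1 \<le> n \<Longrightarrow> 0 \<le> x n"
    and le: "\<And>K. (\<Sum>n=1..K. x n powr q) \<le> c powr q"
  shows "lq_norm (ereal q) X \<le> ennreal c"
proof -
  have "(\<Sum>n. epowr (X (Suc n)) q) \<le> ennreal (c powr q)"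
  proof (rule suminf_le_const)
    fix N
    have "(\<Sum>n<N. epowr (X (Suc n)) q) = ennreal (\<Sum>n<N. x (Suc n) powr q)"
      by (subst sum_ennreal[symmetric]) (auto simp: X epowr_ennreal)
    also have "(\<Sum>n<N. x (Suc n) powr q) = (\<Sum>n=1..N. x n powr q)"
      by (rule sum.reindex_bij_witness[of _ "\<lambda>n. n - 1" Suc]) auto
    also have "ennreal \<dots> \<le> ennreal (c powr q)" by (intro ennreal_leI le)
    finally show "(\<Sum>n<N. epowr (X (Suc n)) q) \<le> ennreal (c powr q)" .
  qed auto
  then have "lq_norm (ereal q) X \<le> epowr (ennreal (c powr q)) (1 / q)"
    using assms(1) unfolding lq_norm_def by (auto intro: epowr_mono)
  also have "\<dots> = ennreal c"
    using assms(1,2) by (simp add: epowr_ennreal powr_powr)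
  finally show ?thesis .
qed

lemma lq_norm_le_ennrealD:
  assumes le: "lq_norm (ereal q) X \<le> ennreal c" and "0 < q" "0 \<le> c"
  shows "1 \<le> n \<Longrightarrow> X n \<noteq> \<infinity>" "(\<Sum>n=1..K. enn2real (X n) powr q) \<le> c powr q"
proof -
  define S where "S = (\<Sum>n. epowr (X (Suc n)) q)"
  have S: "epowr S (1 / q) \<le> ennreal c"
    using le by (simp add: lq_norm_def S_def)
  then have "S \<noteq> \<infinity>" by (auto simp: epowr_def top_unique)
  then obtain s where s: "S = ennreal s" "0 \<le> s" by (cases S) auto
  have "s powr (1 / q) \<le> c" using S s assms by (simp add: epowr_ennreal)
  then have "(s powr (1 / q)) powr q \<le> c powr q" using assms by (intro powr_mono2) auto
  then have sc: "s \<le> c powr q" using assms s by (simp add: powr_powr)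
  have fin: "X (Suc n) \<noteq> \<infinity>" for n
  proof
    assume "X (Suc n) = \<infinity>"
    then have "\<infinity> \<le> S"
      unfolding S_def using sum_le_suminf[of "\<lambda>n. epowr (X (Suc n)) q" "{n}"] by (simp add: epowr_def)
    then show False using \<open>S \<noteq> \<infinity>\<close> by (simp add: top_unique)
  qed
  then show "1 \<le> n \<Longrightarrow> X n \<noteq> \<infinity>" by (cases n) auto
  have "(\<Sum>n=1..K. enn2real (X n) powr q) = (\<Sum>n<K. enn2real (X (Suc n)) powr q)"
    by (rule sum.reindex_bij_witness[of _ Suc "\<lambda>n. n - 1"]) auto
  also have "ennreal \<dots> = (\<Sum>n<K. epowr (X (Suc n)) q)"
    using fin by (subst sum_ennreal[symmetric]) (auto simp: epowr_def)
  also have "\<dots> \<le> S" unfolding S_def by (intro sum_le_suminf) auto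
  finally have "(\<Sum>n=1..K. enn2real (X n) powr q) \<le> s" using s by simp
  then show "(\<Sum>n=1..K. enn2real (X n) powr q) \<le> c powr q" using sc by simp
qed

section \<open>Conjugate exponents and Hoelder's inequality for series\<close>

lemma conj_exp_eqI: "1 \<le> p \<Longrightarrow> 1 \<le> r \<Longrightarrow> 1 / p + 1 / r = 1 \<Longrightarrow> conj_exp p = r"
  unfolding conj_exp_def using conj_exp_ex1[of p] by (intro the1_equality) auto

lemma conj_exp_props: "1 \<le> p \<Longrightarrow> 1 \<le> conj_exp p" "1 \<le> p \<Longrightarrow> 1 / p + 1 / conj_exp p = 1"
  using theI'[OF conj_exp_ex1[of p]] unfolding conj_exp_def by auto

lemma conj_exp_1 [simp]: "conj_exp 1 = \<infinity>"
  by (intro conj_exp_eqI) (auto simp: one_ereal_def divide_ereal_def)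

lemma conj_exp_PInf [simp]: "conj_exp \<infinity> = 1"
  by (intro conj_exp_eqI) (auto simp: one_ereal_def divide_ereal_def)

lemma conj_exp_real: "1 < q \<Longrightarrow> conj_exp (ereal q) = ereal (q / (q - 1))"
  by (intro conj_exp_eqI) (auto simp: one_ereal_def divide_ereal_def field_simps)

lemma lq_norm_Holder:
  fixes X Y :: "nat \<Rightarrow> ennreal"
  assumes "1 \<le> q" "lq_norm q X \<le> 1"
  shows "(\<Sum>n. X (Suc n) * Y (Suc n)) \<le> lq_norm (conj_exp q) Y"
proof -
  consider "q = 1" | "q = \<infinity>" | r where "q = ereal r" "1 < r"
    using assms(1) by (cases q) (auto simp: one_ereal_def le_less)
  then show ?thesis
  proof cases
    case 1
    have "(\<Sum>n. X (Suc n) * Y (Suc n)) \<le> (\<Sum>n. X (Suc n) * lq_norm (conj_exp q) Y)"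
      using 1 by (intro suminf_le mult_left_mono) (auto simp: lq_norm_def intro: SUP_upper)
    also have "\<dots> = lq_norm q X * lq_norm (conj_exp q) Y"
      using 1 by (simp add: lq_norm_one)
    also have "\<dots> \<le> 1 * lq_norm (conj_exp q) Y" using assms by (intro mult_right_mono) auto
    finally show ?thesis by simp
  next
    case 2
    have "X n \<le> 1" if "1 \<le> n" for n
      using assms(2) 2 that by (auto simp: lq_norm_def SUP_le_iff)
    then have "(\<Sum>n. X (Suc n) * Y (Suc n)) \<le> (\<Sum>n. 1 * Y (Suc n))"
      by (intro suminf_le mult_right_mono) auto
    then show ?thesis using 2 by (simp add: lq_norm_one)
  next
    case (3 r)
    define s where "s = r / (r - 1)"
    have s: "1 < s" "1 / r + 1 / s = 1" "conj_exp q = ereal s"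
      using 3 by (auto simp: s_def field_simps conj_exp_real)
    show ?thesis
    \<comment> \<open>If the right side is finite, all entries of both sequences are finite and the
      real inequality applies to partial sums.\<close>
    proof (cases "lq_norm (conj_exp q) Y = \<infinity>")
      case False
      then obtain c where c: "lq_norm (ereal s) Y = ennreal c" "0 \<le> c"
        using s by (cases "lq_norm (ereal s) Y") auto
      have X1: "lq_norm (ereal r) X \<le> ennreal 1" using assms 3 by simp
      have Yc: "lq_norm (ereal s) Y \<le> ennreal c" using c by simp
      note X = lq_norm_le_ennrealD[OF X1] and Y = lq_norm_le_ennrealD[OF Yc]
      have "(\<Sum>n. X (Suc n) * Y (Suc n)) \<le> ennreal c"
      proof (rule suminf_le_const)
        fix N
        have "(\<Sum>n<N. X (Suc n) * Y (Suc n)) = (\<Sum>n=1..N. X n * Y n)"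
          by (rule sum.reindex_bij_witness[of _ "\<lambda>n. n - 1" Suc]) auto
        also have "\<dots> = ennreal (\<Sum>n=1..N. enn2real (X n) * enn2real (Y n))"
        proof (subst sum_ennreal[symmetric], simp, rule sum.cong[OF refl])
          fix n assume "n \<in> {1..N}"
          then have "X n \<noteq> \<infinity>" "Y n \<noteq> \<infinity>" using X(1) Y(1) 3 s c by auto
          then show "X n * Y n = ennreal (enn2real (X n) * enn2real (Y n))"
            by (simp add: ennreal_mult less_top)
        qed
        also have "\<dots> \<le> ennreal (1 * c)"
          using 3 s c X(2) Y(2)
          by (intro ennreal_leI sum_Holder_bound[where p = r and q = s]) auto
        finally show "(\<Sum>n<N. X (Suc n) * Y (Suc n)) \<le> ennreal c" by simp
      qed auto
      then show ?thesis using c s by simp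
    qed simp
  qed
qed

text \<open>Positions are chosen greedily: for \<open>t i > 0\<close> the level set above
  \<open>t i\<close> has at least \<open>i\<close> points, of which at most \<open>i - 1\<close> are
  taken. Where \<open>t i = 0\<close> any free position will do.\<close>

lemma ex_inj_above:
  assumes "\<And>i. i \<in> {1..K} \<Longrightarrow> t i = 0 \<or> t i < rearr a i"
  shows "\<exists>\<pi> :: nat \<Rightarrow> nat. inj_on \<pi> {1..K} \<and> (\<forall>i\<in>{1..K}. 1 \<le> \<pi> i \<and> t i \<le> e2ennreal \<bar>a (\<pi> i)\<bar>)"
  using assms
proof (induction K)
  case (Suc K)
  then obtain \<pi> :: "nat \<Rightarrow> nat" where \<pi>: "inj_on \<pi> {1..K}"
    "\<And>i. i \<in> {1..K} \<Longrightarrow> 1 \<le> \<pi> i \<and> t i \<le> e2ennreal \<bar>a (\<pi> i)\<bar>" by auto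
  have "\<exists>k. 1 \<le> k \<and> k \<notin> \<pi> ` {1..K} \<and> t (Suc K) \<le> e2ennreal \<bar>a k\<bar>"
  proof (cases "t (Suc K) = 0")
    case True
    have "\<not> {1..} \<subseteq> \<pi> ` {1..K}"
      using infinite_Ici[of "1::nat"] finite_subset by blast
    then show ?thesis using True by auto
  next
    case False
    then have "t (Suc K) < rearr a (Suc K)" using Suc.prems[of "Suc K"] by auto
    then obtain S where S: "card S = Suc K" "S \<subseteq> {k \<in> {1..}. t (Suc K) < e2ennreal \<bar>a k\<bar>}"
      using less_rearrD[of "t (Suc K)" a "Suc K"] by auto
    have "\<not> S \<subseteq> \<pi> ` {1..K}"
      using card_mono[of "\<pi> ` {1..K}" S] card_image_le[of "{1..K}" \<pi>] S by auto
    then show ?thesis using S(2) by (fastforce intro: less_imp_le)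
  qed
  then obtain k where k: "1 \<le> k" "k \<notin> \<pi> ` {1..K}" "t (Suc K) \<le> e2ennreal \<bar>a k\<bar>" by blast
  have "inj_on (\<pi>(Suc K := k)) (insert (Suc K) {1..K})"
    using inj_on_fun_updI[OF \<pi>(1) k(2), of "Suc K"] k(2) by (simp add: fun_upd_image)
  then have "inj_on (\<pi>(Suc K := k)) {1..Suc K}" by (simp add: atLeastAtMostSuc_conv)
  moreover have "\<forall>i\<in>{1..Suc K}. 1 \<le> (\<pi>(Suc K := k)) i \<and> t i \<le> e2ennreal \<bar>a ((\<pi>(Suc K := k)) i)\<bar>"
    using \<pi>(2) k by auto
  ultimately show ?case by blast
qed simp

text \<open>The test sequence takes the value g i at the position where a is at least t i, so that its
  rearrangement is at most g. Working below the values of the rearrangement of a is necessary because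
  these need not be attained.\<close>
lemma sum_le_assoc_norm:
  fixes g w :: "nat \<Rightarrow> real"
  assumes q: "0 < q"
    and g: "\<And>n. 0 \<le> g n" "\<And>m n. 1 \<le> m \<Longrightarrow> m \<le> n \<Longrightarrow> g n \<le> g m" "\<And>n. n > K \<Longrightarrow> g n = 0"
    and norm: "lq_norm q (\<lambda>n. ennreal (g n * w n)) \<le> 1"
    and t: "\<And>i. i \<in> {1..K} \<Longrightarrow> t i = 0 \<or> t i < rearr a i"
  shows "(\<Sum>i=1..K. t i * ennreal (g i)) \<le> assoc_norm (\<lambda>b. lq_norm q (\<lambda>n. rearr b n * ennreal (w n))) a"
proof -
  obtain \<pi> :: "nat \<Rightarrow> nat" where \<pi>: "inj_on \<pi> {1..K}"
    "\<And>i. i \<in> {1..K} \<Longrightarrow> 1 \<le> \<pi> i" "\<And>i. i \<in> {1..K} \<Longrightarrow> t i \<le> e2ennreal \<bar>a (\<pi> i)\<bar>"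
    using ex_inj_above[OF t] by blast
  define b :: eseq where
    "b k = (if k \<in> \<pi> ` {1..K} then ereal (g (the_inv_into {1..K} \<pi> k)) else 0)" for k
  have b\<pi>: "b (\<pi> i) = ereal (g i)" if "i \<in> {1..K}" for i
    using that \<pi>(1) by (simp add: b_def the_inv_into_f_f)
  have rearr_b: "rearr b n \<le> ennreal (g n)" if "1 \<le> n" for n
  proof (rule rearr_le)
    \<comment> \<open>As \<open>g\<close> is non-increasing, a value above \<open>g n\<close> can
      only sit at some \<open>\<pi> i\<close> with \<open>i < n\<close>.\<close>
    show "{k \<in> {1..}. ennreal (g n) < e2ennreal \<bar>b k\<bar>} \<subseteq> \<pi> ` ({1..K} \<inter> {1..<n})"
    proof safe
      fix k assume k: "ennreal (g n) < e2ennreal \<bar>b k\<bar>"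
      then have "k \<in> \<pi> ` {1..K}" by (auto simp: b_def e2ennreal_neg split: if_splits)
      then obtain i where i: "k = \<pi> i" "i \<in> {1..K}" by blast
      with k g(1) have "g n < g i" by (simp add: b\<pi> ennreal_less_iff)
      then have "i < n" using g(2)[of n i] \<open>1 \<le> n\<close> by (meson leD leI)
      then show "k \<in> \<pi> ` ({1..K} \<inter> {1..<n})" using i by auto
    qed
    have "card (\<pi> ` ({1..K} \<inter> {1..<n})) \<le> card {1..<n}"
      by (meson Int_lower2 card_image_le card_mono finite_Int finite_atLeastLessThan le_trans)
    then show "card (\<pi> ` ({1..K} \<inter> {1..<n})) < n" using that by simp
  qed auto
  let ?N = "\<lambda>b. lq_norm q (\<lambda>n. rearr b n * ennreal (w n))"
  have "?N b \<le> lq_norm q (\<lambda>n. ennreal (g n * w n))"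
    using rearr_b g(1) by (intro lq_norm_mono q) (auto simp: ennreal_mult' intro!: mult_right_mono)
  with norm have Nb: "?N b \<le> 1" by simp
  then have "?N b < \<infinity>" by (rule order.strict_trans1) simp
  with Nb have "(\<Sum>n. e2ennreal \<bar>a (Suc n) * b (Suc n)\<bar>) \<le> assoc_norm ?N a"
    unfolding assoc_norm_def by (intro SUP_upper) (auto simp: carrier_of_def)
  moreover have "(\<Sum>i=1..K. t i * ennreal (g i)) \<le> (\<Sum>n. e2ennreal \<bar>a (Suc n) * b (Suc n)\<bar>)"
  proof -
    have "(\<Sum>i=1..K. t i * ennreal (g i)) \<le> (\<Sum>i=1..K. e2ennreal \<bar>a (\<pi> i) * b (\<pi> i)\<bar>)"
      using \<pi>(3) g(1) by (intro sum_mono) (simp add: e2ennreal_abs_mult b\<pi> mult_right_mono)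
    \<comment> \<open>The series is indexed from 0, the positions from 1; as all
      \<open>\<pi> i \<ge> 1\<close>, the shift preserves injectivity.\<close>
    also have "\<dots> = (\<Sum>n\<in>(\<lambda>i. \<pi> i - 1) ` {1..K}. e2ennreal \<bar>a (Suc n) * b (Suc n)\<bar>)"
    proof (subst sum.reindex)
      have Suc_\<pi>: "Suc (\<pi> i - 1) = \<pi> i" if "i \<in> {1..K}" for i
        using \<pi>(2)[OF that] by simp
      then show "inj_on (\<lambda>i. \<pi> i - 1) {1..K}"
        using \<pi>(1) unfolding inj_on_def by metis
      show "(\<Sum>i=1..K. e2ennreal \<bar>a (\<pi> i) * b (\<pi> i)\<bar>) =
          sum ((\<lambda>n. e2ennreal \<bar>a (Suc n) * b (Suc n)\<bar>) \<circ> (\<lambda>i. \<pi> i - 1)) {1..K}"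
        by (intro sum.cong refl) (simp only: o_def Suc_\<pi>)
    qed
    also have "\<dots> \<le> (\<Sum>n. e2ennreal \<bar>a (Suc n) * b (Suc n)\<bar>)"
      by (intro sum_le_suminf) auto
    finally show ?thesis .
  qed
  ultimately show ?thesis by (rule order_trans[rotated])
qed

text \<open>Passes to real sequences. The factor 2 arises because test levels must stay strictly
  below the rearrangement, and \<open>f / 2\<close> does so wherever \<open>f\<close> is
  positive.\<close>

lemma assoc_norm_finiteE:
  fixes q :: ereal and w :: "nat \<Rightarrow> real"
  defines "N \<equiv> \<lambda>b. lq_norm q (\<lambda>n. rearr b n * ennreal (w n))"
  assumes q: "0 < q" and w: "w 1 = 1" and fin: "assoc_norm N a < \<infinity>"
  obtains A and f :: "nat \<Rightarrow> real" where "0 \<le> A" "assoc_norm N a = ennreal A"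
    "\<And>n. 1 \<le> n \<Longrightarrow> rearr a n = ennreal (f n)" "\<And>n. 0 \<le> f n"
    "\<And>m n. 1 \<le> m \<Longrightarrow> m \<le> n \<Longrightarrow> f n \<le> f m"
    "\<And>g K. (\<And>n. 0 \<le> g n) \<Longrightarrow> (\<And>m n. 1 \<le> m \<Longrightarrow> m \<le> n \<Longrightarrow> g n \<le> g m) \<Longrightarrow>
        (\<And>n. n > K \<Longrightarrow> g n = 0) \<Longrightarrow> lq_norm q (\<lambda>n. ennreal (g n * w n)) \<le> 1 \<Longrightarrow>
        (\<Sum>n=1..K. f n * g n) \<le> 2 * A"
proof -
  obtain A where A: "0 \<le> A" "assoc_norm N a = ennreal A"
    using fin by (cases "assoc_norm N a") auto
  have "rearr a 1 \<noteq> \<infinity>"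
  proof
    assume inf: "rearr a 1 = \<infinity>"
    \<comment> \<open>A unit mass at 1 has norm at most 1 because \<open>w 1 = 1\<close>. Were the
      rearrangement infinite at 1, testing at level \<open>A + 1\<close> would contradict the value
      \<open>A\<close>.\<close>
    define g :: "nat \<Rightarrow> real" where "g n = (if n = 1 then 1 else 0)" for n
    have "lq_norm q (\<lambda>n. ennreal (g n * w n)) \<le> ennreal 1"
    proof (cases q)
      case (real r)
      have "(\<Sum>n=1..K. g n powr r) = (\<Sum>n=1..K. if n = 1 then 1 else 0)" for K
        by (intro sum.cong) (auto simp: g_def)
      then have "(\<Sum>n=1..K. g n powr r) \<le> 1 powr r" for K by simp
      then show ?thesis unfolding real using q w real
        by (intro lq_norm_le_ennreal[where x = g]) (auto simp: g_def)
    qed (use q w in \<open>auto simp: lq_norm_def g_def intro!: SUP_least\<close>)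
    then have "(\<Sum>i=1..1. ennreal (A + 1) * ennreal (g i)) \<le> assoc_norm N a"
      unfolding N_def using inf by (intro sum_le_assoc_norm q) (auto simp: g_def)
    then show False using A by (simp add: g_def)
  qed
  then have rfin: "rearr a n \<noteq> \<infinity>" if "1 \<le> n" for n
    using rearr_antimono[OF that, of a] by (auto simp: top_unique)
  define f where "f n = enn2real (rearr a n)" for n
  have f: "rearr a n = ennreal (f n)" if "1 \<le> n" for n
    using rfin[OF that] by (simp add: f_def less_top)
  show ?thesis
  proof (rule that[OF A f])
    show "0 \<le> f n" for n by (simp add: f_def)
    show "f n \<le> f m" if "1 \<le> m" "m \<le> n" for m n
      unfolding f_def using rearr_antimono[OF that(2), of a] rfin[of m] that
      by (intro enn2real_mono) (auto simp: less_top)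
  next
    fix g :: "nat \<Rightarrow> real" and K
    assume g: "\<And>n. 0 \<le> g n" "\<And>m n. 1 \<le> m \<Longrightarrow> m \<le> n \<Longrightarrow> g n \<le> g m" "\<And>n. n > K \<Longrightarrow> g n = 0"
      and norm: "lq_norm q (\<lambda>n. ennreal (g n * w n)) \<le> 1"
    have "(\<Sum>i=1..K. ennreal (f i / 2) * ennreal (g i)) \<le> assoc_norm N a"
      unfolding N_def
    proof (rule sum_le_assoc_norm[OF q g norm])
      fix i assume "i \<in> {1..K}"
      then have "rearr a i = ennreal (f i)" "0 \<le> f i" using f[of i] by (auto simp: f_def)
      then show "ennreal (f i / 2) = 0 \<or> ennreal (f i / 2) < rearr a i"
        by (cases "f i = 0") (simp_all add: ennreal_less_iff)
    qed
    also have "(\<Sum>i=1..K. ennreal (f i / 2) * ennreal (g i)) = ennreal (\<Sum>i=1..K. f i / 2 * g i)"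
    proof -
      have "ennreal (f i / 2) * ennreal (g i) = ennreal (f i / 2 * g i)" for i
        using g(1) by (intro ennreal_mult[symmetric]) (auto simp: f_def)
      then show ?thesis using g(1) by (simp only:) (intro sum_ennreal, simp add: f_def)
    qed
    finally have "(\<Sum>i=1..K. f i / 2 * g i) \<le> A" using A by simp
    then show "(\<Sum>n=1..K. f n * g n) \<le> 2 * A"
      by (simp add: sum_divide_distrib[symmetric])
  qed
qed

section \<open>The two norm inequalities for a general weight\<close>

lemma assoc_norm_le_lq_norm:
  fixes w w' :: "nat \<Rightarrow> real"
  assumes q: "1 \<le> q" and w: "\<And>n. 1 \<le> n \<Longrightarrow> 0 < w n" and w': "\<And>n. 1 \<le> n \<Longrightarrow> w' n = 1 / w n"
  shows "assoc_norm (\<lambda>b. lq_norm q (\<lambda>n. rearr b n * ennreal (w n))) a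
    \<le> lq_norm (conj_exp q) (\<lambda>n. rearr a n * ennreal (w' n))"
  unfolding assoc_norm_def
proof (rule SUP_least)
  fix b assume b: "b \<in> {b \<in> carrier_of (\<lambda>b. lq_norm q (\<lambda>n. rearr b n * ennreal (w n))).
      lq_norm q (\<lambda>n. rearr b n * ennreal (w n)) \<le> 1}"
  have "(\<Sum>n. e2ennreal \<bar>a (Suc n) * b (Suc n)\<bar>) \<le> (\<Sum>n. rearr a (Suc n) * rearr b (Suc n))"
    by (rule Hardy_Littlewood_rearr)
  \<comment> \<open>The reciprocal weights are inserted so that the factor with \<open>b\<close> is
    the one whose norm is at most 1.\<close>
  also have "\<dots> = (\<Sum>n. (rearr b (Suc n) * ennreal (w (Suc n))) * (rearr a (Suc n) * ennreal (w' (Suc n))))"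
  proof (rule suminf_cong)
    fix n
    have "ennreal (w (Suc n)) * ennreal (w' (Suc n)) = 1"
      using w[of "Suc n"] w'[of "Suc n"] by (simp add: ennreal_mult[symmetric])
    then show "rearr a (Suc n) * rearr b (Suc n)
        = (rearr b (Suc n) * ennreal (w (Suc n))) * (rearr a (Suc n) * ennreal (w' (Suc n)))"
      by (metis mult.assoc mult.commute mult.right_neutral)
  qed
  also have "\<dots> \<le> lq_norm (conj_exp q) (\<lambda>n. rearr a n * ennreal (w' n))"
    using b by (intro lq_norm_Holder q) auto
  finally show "(\<Sum>n. e2ennreal \<bar>a (Suc n) * b (Suc n)\<bar>) \<le> lq_norm (conj_exp q) (\<lambda>n. rearr a n * ennreal (w' n))" .
qed

text \<open>For \<open>q > 1\<close> this is \<open>norm_le_of_test_sequences\<close> with bound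
  \<open>2 * A\<close>. For \<open>q = 1\<close> the conjugate norm is a supremum, and each of its
  terms is tested by a normalised indicator.\<close>

lemma lq_norm_le_assoc_norm:
  fixes w w' :: "nat \<Rightarrow> real"
  assumes w: "\<And>n. 1 \<le> n \<Longrightarrow> 0 < w n" "w 1 = 1" and w': "\<And>n. 1 \<le> n \<Longrightarrow> w' n = 1 / w n"
    and C: "0 < C" and q: "1 \<le> q"
    and B: "\<And>k. (\<Sum>n=1..k. w n powr q) \<le> C * (real k * w k powr q)"
  shows "lq_norm (conj_exp (ereal q)) (\<lambda>n. rearr a n * ennreal (w' n))
    \<le> ennreal (2 * q * C) * assoc_norm (\<lambda>b. lq_norm (ereal q) (\<lambda>n. rearr b n * ennreal (w n))) a"
    (is "_ \<le> _ * ?A")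
proof (cases "?A < \<infinity>")
  case True
  have q0: "0 < ereal q" using q by simp
  obtain A f where f: "0 \<le> A" "?A = ennreal A"
    "\<And>n. 1 \<le> n \<Longrightarrow> rearr a n = ennreal (f n)" "\<And>n. 0 \<le> f n"
    "\<And>m n. 1 \<le> m \<Longrightarrow> m \<le> n \<Longrightarrow> f n \<le> f m"
    and test: "\<And>g K. (\<And>n. 0 \<le> g n) \<Longrightarrow> (\<And>m n. 1 \<le> m \<Longrightarrow> m \<le> n \<Longrightarrow> g n \<le> g m) \<Longrightarrow>
        (\<And>n. n > K \<Longrightarrow> g n = 0) \<Longrightarrow> lq_norm (ereal q) (\<lambda>n. ennreal (g n * w n)) \<le> 1 \<Longrightarrow>
        (\<Sum>n=1..K. f n * g n) \<le> 2 * A"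
    by (fact assoc_norm_finiteE[OF q0 w(2) True])
  have test': "(\<Sum>n=1..K. f n * g n) \<le> 2 * A"
    if g: "\<And>n. 0 \<le> g n" "\<And>m n. 1 \<le> m \<Longrightarrow> m \<le> n \<Longrightarrow> g n \<le> g m" "\<And>n. n > K \<Longrightarrow> g n = 0"
      and le: "(\<Sum>n=1..K. (g n * w n) powr q) \<le> 1" for g K
  proof (rule test[OF g])
    \<comment> \<open>Entries of \<open>g\<close> beyond \<open>K\<close> vanish, so the bound up to
      \<open>K\<close> holds for all partial sums.\<close>
    have "(\<Sum>n=1..L. (g n * w n) powr q) \<le> 1 powr q" for L
    proof -
      have "(\<Sum>n=1..L. (g n * w n) powr q) \<le> (\<Sum>n\<in>{1..K} \<union> {1..L}. (g n * w n) powr q)"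
        by (intro sum_mono2) auto
      also have "\<dots> = (\<Sum>n=1..K. (g n * w n) powr q)"
        using g(3) by (intro sum.mono_neutral_right) auto
      finally show ?thesis using le by simp
    qed
    then have "lq_norm (ereal q) (\<lambda>n. ennreal (g n * w n)) \<le> ennreal 1"
      using q w(1) g(1)
      by (intro lq_norm_le_ennreal[where x = "\<lambda>n. g n * w n"]) (auto simp: less_imp_le)
    then show "lq_norm (ereal q) (\<lambda>n. ennreal (g n * w n)) \<le> 1" by simp
  qed
  have X: "rearr a n * ennreal (w' n) = ennreal (f n / w n)" if "1 \<le> n" for n
    using that w(1)[OF that] by (simp add: f w' ennreal_mult[symmetric])
  have "lq_norm (conj_exp (ereal q)) (\<lambda>n. rearr a n * ennreal (w' n)) \<le> ennreal (q * C * (2 * A))"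
  proof (cases "q = 1")
    case False
    define r where "r = q / (q - 1)"
    have r: "1 < r" "1 / q + 1 / r = 1" "conj_exp (ereal q) = ereal r"
      using False q by (auto simp: r_def field_simps conj_exp_real)
    show ?thesis
      unfolding r(3)
    proof (rule lq_norm_le_ennreal[where x = "\<lambda>n. f n / w n"])
      show "(\<Sum>n=1..K. (f n / w n) powr r) \<le> (q * C * (2 * A)) powr r" for K
        using False q r f w(1) C B test' by (intro norm_le_of_test_sequences) auto
    qed (use q C f r w(1) X in \<open>auto simp: less_imp_le\<close>)
  next
    case True
    have "f n / w n \<le> C * (2 * A)" if n: "1 \<le> n" for n
    proof -
      \<comment> \<open>\<open>W\<close> is the weighted l^1 norm of the indicator of
        \<open>1..n\<close>. Monotonicity of \<open>f\<close> gives
        \<open>n * f n / W \<le> 2 * A\<close>, and \<open>B\<close> bounds \<open>W\<close> by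
        \<open>C * (n * w n)\<close>.\<close>
      define W where "W = (\<Sum>i=1..n. w i)"
      have W: "W \<le> C * (real n * w n)"
      proof -
        have "(\<Sum>i=1..n. w i powr q) = W"
          unfolding W_def using w(1) True by (intro sum.cong) (auto simp: less_imp_le)
        then show ?thesis using B[of n] w(1)[OF n] True by (simp add: less_imp_le)
      qed
      have "w n \<le> W" unfolding W_def using n w(1) by (intro member_le_sum) (auto intro: less_imp_le)
      then have W0: "0 < W" using w(1)[OF n] by simp
      have "(\<Sum>i=1..n. f i * (if i \<le> n then 1 / W else 0)) \<le> 2 * A"
      proof (rule test')
        have "(\<Sum>i=1..n. ((if i \<le> n then 1 / W else 0) * w i) powr q) = (\<Sum>i=1..n. w i / W)"
          using W0 w(1) True by (intro sum.cong) (auto simp: less_imp_le)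
        also have "\<dots> = 1" using W0 by (simp add: W_def sum_divide_distrib[symmetric])
        finally show "(\<Sum>i=1..n. ((if i \<le> n then 1 / W else 0) * w i) powr q) \<le> 1" by simp
      qed (use W0 in auto)
      moreover have "(\<Sum>i=1..n. f n / W) \<le> (\<Sum>i=1..n. f i * (if i \<le> n then 1 / W else 0))"
        using W0 f(5) by (intro sum_mono) (auto intro!: divide_right_mono)
      ultimately have "(\<Sum>i=1..n. f n / W) \<le> 2 * A" by (rule order_trans[rotated])
      then have "real n * f n / W \<le> 2 * A" by simp
      then have "real n * f n \<le> 2 * A * W" using W0 by (simp only: pos_divide_le_eq)
      also have "\<dots> \<le> 2 * A * (C * (real n * w n))" using W f(1) by (intro mult_left_mono) auto
      finally have "real n * f n \<le> real n * (C * (2 * A) * w n)" by (simp add: mult_ac)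
      then show ?thesis using n w(1)[OF n] by (simp add: divide_le_eq)
    qed
    then show ?thesis
      using True X by (auto simp: lq_norm_def one_ereal_def[symmetric] intro!: SUP_least ennreal_leI)
  qed
  also have "\<dots> = ennreal (2 * q * C) * ?A"
    using q C f by (simp add: ennreal_mult[symmetric] mult_ac)
  finally show ?thesis .
next
  case False
  then have "?A = top" by (simp add: less_top[symmetric])
  then show ?thesis using q C by (simp add: ennreal_mult_top)
qed

text \<open>As \<open>w\<close> is non-decreasing, \<open>1 / w\<close> cut off after
  \<open>K\<close> is an admissible test sequence, and its pairing with \<open>f\<close> is a
  partial sum of the left side.\<close>

lemma lq_norm_le_assoc_norm_infinity:
  fixes w w' :: "nat \<Rightarrow> real"
  assumes w: "\<And>n. 1 \<le> n \<Longrightarrow> 0 < w n" "w 1 = 1" and w': "\<And>n. 1 \<le> n \<Longrightarrow> w' n = 1 / w n"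
    and mono: "\<And>m n. 1 \<le> m \<Longrightarrow> m \<le> n \<Longrightarrow> w m \<le> w n"
  shows "lq_norm 1 (\<lambda>n. rearr a n * ennreal (w' n)) 
    \<le> ennreal 2 * assoc_norm (\<lambda>b. lq_norm \<infinity> (\<lambda>n. rearr b n * ennreal (w n))) a"
    (is "_ \<le> _ * ?A")
proof (cases "?A < \<infinity>")
  case True
  have q0: "0 < (\<infinity> :: ereal)" by simp
  obtain A f where f: "0 \<le> A" "?A = ennreal A"
    "\<And>n. 1 \<le> n \<Longrightarrow> rearr a n = ennreal (f n)" "\<And>n. 0 \<le> f n"
    "\<And>m n. 1 \<le> m \<Longrightarrow> m \<le> n \<Longrightarrow> f n \<le> f m"
    and test: "\<And>g K. (\<And>n. 0 \<le> g n) \<Longrightarrow> (\<And>m n. 1 \<le> m \<Longrightarrow> m \<le> n \<Longrightarrow> g n \<le> g m) \<Longrightarrow>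
        (\<And>n. n > K \<Longrightarrow> g n = 0) \<Longrightarrow> lq_norm \<infinity> (\<lambda>n. ennreal (g n * w n)) \<le> 1 \<Longrightarrow>
        (\<Sum>n=1..K. f n * g n) \<le> 2 * A"
    by (fact assoc_norm_finiteE[OF q0 w(2) True])
  have "lq_norm (ereal 1) (\<lambda>n. rearr a n * ennreal (w' n)) \<le> ennreal (2 * A)"
  proof (rule lq_norm_le_ennreal[where x = "\<lambda>n. f n / w n"])
    fix K
    define g where "g n = (if 1 \<le> n \<and> n \<le> K then 1 / w n else 0)" for n
    have "(\<Sum>n=1..K. f n * g n) \<le> 2 * A"
    proof (rule test)
      show "0 \<le> g n" for n using w(1)[of n] by (auto simp: g_def intro: less_imp_le)
      show "g n \<le> g m" if "1 \<le> m" "m \<le> n" for m n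
        using mono[OF that] w(1)[of m] w(1)[of n] that by (auto simp: g_def frac_le)
      show "lq_norm \<infinity> (\<lambda>n. ennreal (g n * w n)) \<le> 1"
      proof -
        have "g n * w n \<le> 1" if "1 \<le> n" for n using w(1)[OF that] that by (simp add: g_def)
        then show ?thesis by (auto simp: lq_norm_def intro!: SUP_least)
      qed
    qed (simp add: g_def)
    moreover have "(\<Sum>n=1..K. (f n / w n) powr 1) = (\<Sum>n=1..K. f n * g n)"
      using f(4) w(1) by (intro sum.cong) (auto simp: g_def less_imp_le)
    ultimately show "(\<Sum>n=1..K. (f n / w n) powr 1) \<le> (2 * A) powr 1" using f(1) by simp
  next
    fix n :: nat assume "1 \<le> n"
    then show "rearr a n * ennreal (w' n) = ennreal (f n / w n)" "0 \<le> f n / w n"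
      using w(1)[of n] f(4)[of n] by (simp_all add: f(3) w' ennreal_mult[symmetric])
  qed (use f in auto)
  then show ?thesis using f by (simp add: one_ereal_def ennreal_mult)
next
  case False
  then have "?A = top" by (simp add: less_top[symmetric])
  then show ?thesis by (simp add: ennreal_mult_top)
qed

theorem proposition5p7:
  fixes p q :: ereal and \<alpha> :: real
  assumes "(1 \<le> p \<and> p < \<infinity> \<and> 1 < q \<and> q < \<infinity>)
         \<or> (1 \<le> p \<and> p < \<infinity> \<and> q = 1 \<and> \<alpha> \<le> 0)
         \<or> (1 < p \<and> p \<le> \<infinity> \<and> q = \<infinity> \<and> \<alpha> \<ge> 0)"
  shows "spaces_coincide (assoc_norm (lz_norm p q \<alpha>)) (lz_norm (conj_exp p) (conj_exp q) (- \<alpha>))"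
proof -
  have p: "1 \<le> p" and q: "1 \<le> q" using assms by auto
  define w where "w n = real n powr real_of_ereal (1 / p - 1 / q) * (1 + ln (real n)) powr \<alpha>" for n
  define w' where "w' n = real n powr real_of_ereal (1 / conj_exp p - 1 / conj_exp q)
    * (1 + ln (real n)) powr (- \<alpha>)" for n
  have lz: "lz_norm p q \<alpha> = (\<lambda>b. lq_norm q (\<lambda>n. rearr b n * ennreal (w n)))"
    "lz_norm (conj_exp p) (conj_exp q) (- \<alpha>) = (\<lambda>b. lq_norm (conj_exp q) (\<lambda>n. rearr b n * ennreal (w' n)))"
    by (auto simp: lz_norm_def w_def w'_def)
  have w: "0 < w n" if "1 \<le> n" for n
  proof -
    have "0 < 1 + ln (real n)" using that by (intro add_pos_nonneg) auto
    then show ?thesis using that by (simp add: w_def)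
  qed
  have w1: "w 1 = 1" by (simp add: w_def)
  \<comment> \<open>Conjugation replaces a reciprocal \<open>s\<close> by \<open>1 - s\<close>, also
    for infinite exponents, so the weight exponent becomes
    \<open>(1 - s) - (1 - t) = - (s - t)\<close>.\<close>
  have inv: "\<exists>s. 0 \<le> s \<and> 1 / x = ereal s \<and> 1 / conj_exp x = ereal (1 - s)" if x: "1 \<le> x" for x :: ereal
  proof -
    have "\<exists>s. 0 \<le> s \<and> 1 / x = ereal s"
      using x by (cases x) (auto simp: one_ereal_def divide_ereal_def)
    then obtain s where s: "0 \<le> s" "1 / x = ereal s" by blast
    then have "1 / conj_exp x = ereal (1 - s)"
      using conj_exp_props(2)[OF x] by (cases "1 / conj_exp x") (auto simp: one_ereal_def)
    with s show ?thesis by blast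
  qed
  obtain s where s: "0 \<le> s" "1 / p = ereal s" "1 / conj_exp p = ereal (1 - s)" using inv[OF p] by blast
  obtain t where t: "1 / q = ereal t" "1 / conj_exp q = ereal (1 - t)" using inv[OF q] by blast
  have w_st: "w n = real n powr (s - t) * (1 + ln (real n)) powr \<alpha>" for n by (simp add: w_def s t)
  have w': "w' n = 1 / w n" if "1 \<le> n" for n
  proof -
    have "w' n = real n powr (- (s - t)) * (1 + ln (real n)) powr (- \<alpha>)" by (simp add: w'_def s t)
    then show ?thesis by (simp only: w_st powr_minus) (simp add: field_simps)
  qed
  have upper: "assoc_norm (lz_norm p q \<alpha>) a \<le> lz_norm (conj_exp p) (conj_exp q) (- \<alpha>) a" for a
    unfolding lz by (rule assoc_norm_le_lq_norm[where w = w and w' = w', OF q w w'])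
  have "\<exists>C>0. \<forall>a. lz_norm (conj_exp p) (conj_exp q) (- \<alpha>) a \<le> ennreal C * assoc_norm (lz_norm p q \<alpha>) a"
  proof (cases "q = \<infinity>")
    case True
    \<comment> \<open>With \<open>t = 0\<close> both exponents \<open>s\<close> and
      \<open>\<alpha>\<close> of the weight are nonnegative, so it is non-decreasing.\<close>
    then have \<alpha>: "0 \<le> \<alpha>" and "t = 0" using assms t by (auto simp: divide_ereal_def)
    have "w m \<le> w n" if "1 \<le> m" "m \<le> n" for m n
      unfolding w_st using that s(1) \<open>t = 0\<close> \<alpha> by (intro mult_mono powr_mono2) auto
    from lq_norm_le_assoc_norm_infinity[where w = w and w' = w', OF w w1 w' this]
    show ?thesis unfolding lz using True by (intro exI[of _ 2]) auto
  next
    case False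
    \<comment> \<open>Finite \<open>p\<close> makes \<open>s = 1 / p\<close> positive, as
      \<open>sum_powr_log_le\<close> requires of its exponent \<open>s * r\<close>.\<close>
    with q assms have "p < \<infinity>" by auto
    then have "0 < s" using p s by (cases p) (auto simp: one_ereal_def divide_ereal_def)
    obtain r where r: "q = ereal r" "1 \<le> r" using q False by (cases q) auto
    then have t': "t = 1 / r" using t by (simp add: one_ereal_def divide_ereal_def divide_inverse split: if_splits)
    have "0 < s * r" using \<open>0 < s\<close> r by simp
    then obtain C where C: "0 < C"
      "\<And>k. (\<Sum>n=1..k. real n powr (s * r - 1) * (1 + ln (real n)) powr (\<alpha> * r))
         \<le> C * (real k powr (s * r) * (1 + ln (real k)) powr (\<alpha> * r))"
      using sum_powr_log_le by blast
    \<comment> \<open>Since \<open>t * r = 1\<close>, the exponent \<open>(s - t) * r\<close> is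
      \<open>s * r - 1\<close>.\<close>
    have wr: "w n powr r = real n powr (s * r - 1) * (1 + ln (real n)) powr (\<alpha> * r)" for n
      using r by (simp add: w_st t' powr_mult powr_powr left_diff_distrib)
    have B: "(\<Sum>n=1..k. w n powr r) \<le> C * (real k * w k powr r)" for k
    proof -
      have "real k * real k powr (s * r - 1) = real k powr (s * r)"
        using powr_add[of "real k" 1 "s * r - 1"] by (cases "k = 0") auto
      then show ?thesis using C(2)[of k] by (simp add: wr mult.assoc[symmetric])
    qed
    from lq_norm_le_assoc_norm[where w = w and w' = w', OF w w1 w' C(1) r(2) B]
    show ?thesis unfolding lz unfolding r(1) using C(1) r(2) by (intro exI[of _ "2 * r * C"]) auto
  qed
  then obtain C where "0 < C"
    "\<And>a. lz_norm (conj_exp p) (conj_exp q) (- \<alpha>) a \<le> ennreal C * assoc_norm (lz_norm p q \<alpha>) a" by blast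
  then show ?thesis
    unfolding spaces_coincide_def using upper by (intro exI[of _ 1] exI[of _ C]) auto
qed

end
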